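(* Let $\mathbb{X}$ be a vector lattice and $x_0,x,y\in\mathbb{X}$. Then the following statements are equivalent: (1) $x\sim_{x_0}y$; (2) $x^+\sim_{x_0}y^+$ and $x^-\sim_{x_0}y^-$; (3) $x\vee y\sim_{x_0}x\wedge y$; (4) $x\vee z\sim_{x_0}y\vee z$ and $x\wedge z\sim_{x_0}y\wedge z$ for all $z\in\mathbb{X}$.
   Context: A vector lattice (Riesz space) is a real ordered vector space in which the supremum of any pair of elements exists; $x\vee y=\sup\{x,y\}$, $x\wedge y=\inf\{x,y\}$, $|x|=x\vee(-x)$, $x^+=\frac12(|x|+x)$, $x^-=\frac12(|x|-x)$. For $x,y\ge 0$, $x\perp y$ means $|x-y|=x+y$; for arbitrary $x,y\in\mathbb{X}$, $x\perp y$ means $|x|\perp|y|$. For $x_0,x,y\in\mathbb{X}$, $x\sim_{x_0}y$ (strong relation) means $(x-y)\perp x_0$. *)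

theory Defs
  imports "HOL-Library.Lattice_Algebras"
begin

(* A vector lattice only needs binary suprema, since inf x y = - sup (- x) (- y) then exists
   as well. The modulus is \<bar>x\<bar> = sup x (- x), the axiom abs_lattice. *)
class vector_lattice = ordered_real_vector + lattice_ab_group_add_abs

instance real :: vector_lattice
  by standard (simp add: sup_real_def max_def abs_if)

definition pos_part :: "'a::vector_lattice \<Rightarrow> 'a" where
  "pos_part x = (1/2) *\<^sub>R (\<bar>x\<bar> + x)"

(* Nonnegative, unlike nprt from the library: neg_part x = - nprt x. *)
definition neg_part :: "'a::vector_lattice \<Rightarrow> 'a" where
  "neg_part x = (1/2) *\<^sub>R (\<bar>x\<bar> - x)"

definition nonneg_orthogonal :: "'a::vector_lattice \<Rightarrow> 'a \<Rightarrow> bool" where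
  "nonneg_orthogonal x y \<longleftrightarrow> 0 \<le> x \<and> 0 \<le> y \<and> \<bar>x - y\<bar> = x + y"

(* For nonnegative x and y the moduli disappear, so this extends nonneg_orthogonal. *)
definition orthogonal :: "'a::vector_lattice \<Rightarrow> 'a \<Rightarrow> bool" where
  "orthogonal x y \<longleftrightarrow> nonneg_orthogonal \<bar>x\<bar> \<bar>y\<bar>"

definition strongly_related :: "'a::vector_lattice \<Rightarrow> 'a \<Rightarrow> 'a \<Rightarrow> bool" where
  "strongly_related x0 x y \<longleftrightarrow> orthogonal (x - y) x0"

end

theory Submission
  imports Defs
begin

text \<open>
  The elements orthogonal to \<open>x0\<close> form an ideal of the vector lattice: they are closed under
  addition (\<open>orthogonal_add\<close>) and, with \<open>v\<close>, contain every \<open>u\<close> with \<open>\<bar>u\<bar> \<le> \<bar>v\<bar>\<close>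
  (\<open>orthogonal_solid\<close>). To see this, read orthogonality as vanishing of the infimum of the moduli
  (\<open>orthogonal_iff_inf_abs\<close>); this infimum is monotone, and subadditive by \<open>inf_add_le\<close>.

  Each of the conditions compares \<open>x - y\<close> with other elements modulo this ideal. For any \<open>z\<close>,
  \<open>x - y\<close> is the sum of \<open>sup x z - sup y z\<close> and \<open>inf x z - inf y z\<close>, since
  \<open>x + z = sup x z + inf x z\<close>; conversely, the lattice operations do not increase distances,
  so each of these two differences is dominated by \<open>x - y\<close>. Hence \<open>x\<close> and \<open>y\<close> are related iff
  their suprema with \<open>z\<close> and their infima with \<open>z\<close> are, already for one fixed \<open>z\<close>
  (\<open>strongly_related_iff_sup_inf\<close>). This is the condition on all \<open>z\<close>, and its case \<open>z = 0\<close> is the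
  condition on positive and negative parts. The remaining condition holds because
  \<open>sup x y - inf x y = \<bar>x - y\<bar>\<close>.
\<close>

lemma sup_diff_inf_eq_abs_diff:
  fixes x y :: "'a::vector_lattice"
  shows "sup x y - inf x y = \<bar>x - y\<bar>"
proof -
  have "sup x y - inf x y = sup x y + sup (- x) (- y)"
    by (simp only: diff_conv_add_uminus neg_inf_eq_sup)
  also have "\<dots> = sup (sup (x + - x) (y + - x)) (sup (x + - y) (y + - y))"
    by (simp only: add_sup_distrib_left add_sup_distrib_right)
  also have "\<dots> = sup (sup (x - y) (- (x - y))) 0"
    by (simp add: sup.commute sup.left_commute)
  also have "\<dots> = \<bar>x - y\<bar>"
    by (simp only: abs_lattice[symmetric] sup.absorb1 abs_ge_zero)
  finally show ?thesis .
qed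

text \<open>Add \<open>\<bar>x\<bar> = sup x 0 - inf x 0\<close> and \<open>x = sup x 0 + inf x 0\<close>.\<close>

lemma pos_part_eq_sup:
  fixes x :: "'a::vector_lattice"
  shows "pos_part x = sup x 0"
proof -
  have "\<bar>x\<bar> + x = (sup x 0 - inf x 0) + (sup x 0 + inf x 0)"
    by (simp only: sup_diff_inf_eq_abs_diff add_eq_inf_sup[symmetric] diff_zero add_0_right)
  also have "\<dots> = 2 *\<^sub>R sup x 0"
    \<comment> \<open>Turning \<open>- inf\<close> into a supremum would hide the cancellation.\<close>
    by (simp add: scaleR_2 del: diff_inf_eq_sup)
  finally show ?thesis
    by (simp add: pos_part_def)
qed

lemma neg_part_eq_inf:
  fixes x :: "'a::vector_lattice"
  shows "neg_part x = - inf x 0"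
proof -
  have "neg_part x = pos_part (- x)"
    by (simp add: neg_part_def pos_part_def)
  then show ?thesis
    by (simp add: pos_part_eq_sup neg_inf_eq_sup)
qed

lemma abs_sup_diff_sup_le:
  fixes x y z :: "'a::vector_lattice"
  shows "\<bar>sup x z - sup y z\<bar> \<le> \<bar>x - y\<bar>"
proof -
  have one_sided: "sup a z - sup b z \<le> \<bar>a - b\<bar>" for a b :: 'a
  proof -
    have "a \<le> \<bar>a - b\<bar> + b"
      using abs_ge_self[of "a - b"] by (simp add: diff_le_eq)
    also have "\<dots> \<le> \<bar>a - b\<bar> + sup b z"
      by simp
    finally have "a \<le> \<bar>a - b\<bar> + sup b z" .
    moreover have "z \<le> \<bar>a - b\<bar> + sup b z"
      using add_mono[OF abs_ge_zero, of z "sup b z" "a - b"] by simp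
    ultimately show ?thesis
      by (simp only: diff_le_eq le_sup_iff)
  qed
  show ?thesis
    using one_sided[of x y] one_sided[of y x]
    by (intro abs_leI) (simp_all only: minus_diff_eq abs_minus_commute)
qed

text \<open>Negation exchanges suprema and infima, so this is dual to the estimate for suprema.\<close>

lemma abs_inf_diff_inf_le:
  fixes x y z :: "'a::vector_lattice"
  shows "\<bar>inf x z - inf y z\<bar> \<le> \<bar>x - y\<bar>"
proof -
  have "\<bar>inf x z - inf y z\<bar> = \<bar>sup (- x) (- z) - sup (- y) (- z)\<bar>"
    by (simp only: neg_inf_eq_sup[symmetric] minus_diff_minus abs_minus_cancel)
  also have "\<dots> \<le> \<bar>- x - - y\<bar>"
    by (rule abs_sup_diff_sup_le)
  also have "\<dots> = \<bar>x - y\<bar>"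
    by (simp only: minus_diff_minus abs_minus_cancel)
  finally show ?thesis .
qed

text \<open>
  For \<open>a = \<bar>x\<bar>\<close> and \<open>b = \<bar>y\<bar>\<close> one has \<open>\<bar>a - b\<bar> = sup a b - inf a b = a + b - 2 inf a b\<close>,
  and a vector lattice has no 2-torsion.
\<close>

lemma orthogonal_iff_inf_abs:
  fixes x y :: "'a::vector_lattice"
  shows "orthogonal x y \<longleftrightarrow> inf \<bar>x\<bar> \<bar>y\<bar> = 0"
proof -
  let ?m = "inf \<bar>x\<bar> \<bar>y\<bar>"
  have "\<bar>\<bar>x\<bar> - \<bar>y\<bar>\<bar> = \<bar>x\<bar> + \<bar>y\<bar> - 2 *\<^sub>R ?m"
    using add_eq_inf_sup[of "\<bar>x\<bar>" "\<bar>y\<bar>"]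
    by (simp add: scaleR_2 algebra_simps flip: sup_diff_inf_eq_abs_diff)
  then show ?thesis
    by (simp add: orthogonal_def nonneg_orthogonal_def)
qed

lemma orthogonal_solid:
  fixes u v w :: "'a::vector_lattice"
  assumes "orthogonal v w" and "\<bar>u\<bar> \<le> \<bar>v\<bar>"
  shows "orthogonal u w"
proof -
  have "inf \<bar>u\<bar> \<bar>w\<bar> \<le> inf \<bar>v\<bar> \<bar>w\<bar>"
    using assms(2) by (intro inf_mono) auto
  with assms(1) show ?thesis
    by (simp add: orthogonal_iff_inf_abs order.antisym)
qed

text \<open>
  Since addition distributes over infima, the right-hand side is the infimum of the four sums
  \<open>a + b\<close>, \<open>a + c\<close>, \<open>c + b\<close> and \<open>c + c\<close>, and nonnegativity bounds the left-hand side by each.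
\<close>

lemma inf_add_le:
  fixes a b c :: "'a::vector_lattice"
  assumes "0 \<le> a" "0 \<le> b" "0 \<le> c"
  shows "inf (a + b) c \<le> inf a c + inf b c"
proof -
  have "inf (a + b) c \<le> a + c" "inf (a + b) c \<le> c + b" "inf (a + b) c \<le> c + c"
    using assms by (auto intro: le_infI2 add_increasing add_increasing2)
  then show ?thesis
    by (simp add: add_inf_distrib_left add_inf_distrib_right)
qed

lemma orthogonal_add:
  fixes u v w :: "'a::vector_lattice"
  assumes "orthogonal u w" and "orthogonal v w"
  shows "orthogonal (u + v) w"
proof -
  have "inf \<bar>u + v\<bar> \<bar>w\<bar> \<le> inf (\<bar>u\<bar> + \<bar>v\<bar>) \<bar>w\<bar>"
    by (intro inf_mono abs_triangle_ineq order.refl)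
  also have "\<dots> \<le> inf \<bar>u\<bar> \<bar>w\<bar> + inf \<bar>v\<bar> \<bar>w\<bar>"
    by (intro inf_add_le) auto
  finally show ?thesis
    using assms by (simp add: orthogonal_iff_inf_abs order.antisym)
qed

lemma strongly_related_uminus [simp]:
  fixes x0 x y :: "'a::vector_lattice"
  shows "strongly_related x0 (- x) (- y) \<longleftrightarrow> strongly_related x0 x y"
  using abs_minus_commute[of x y] by (simp add: strongly_related_def orthogonal_def)

text \<open>
  A single \<open>z\<close> suffices because \<open>sup x z\<close> and \<open>inf x z\<close> together determine \<open>x\<close>, as
  \<open>sup x z + inf x z - z\<close>. The choice \<open>z = 0\<close> gives the positive part and minus the negative part.
\<close>

lemma strongly_related_iff_sup_inf:
  fixes x0 x y z :: "'a::vector_lattice"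
  shows "strongly_related x0 x y \<longleftrightarrow>
    strongly_related x0 (sup x z) (sup y z) \<and> strongly_related x0 (inf x z) (inf y z)"
proof -
  have "x - y = (x + z) - (y + z)"
    by simp
  also have "\<dots> = (sup x z + inf x z) - (sup y z + inf y z)"
    by (simp only: add_eq_inf_sup[symmetric])
  also have "\<dots> = (sup x z - sup y z) + (inf x z - inf y z)"
    by (simp only: add_diff_add)
  finally have split: "x - y = (sup x z - sup y z) + (inf x z - inf y z)" .
  show ?thesis
    unfolding strongly_related_def
    using orthogonal_add[of "sup x z - sup y z" x0 "inf x z - inf y z", folded split]
      orthogonal_solid[OF _ abs_sup_diff_sup_le[of x z y]]
      orthogonal_solid[OF _ abs_inf_diff_inf_le[of x z y]]
    by blast
qed

theorem proposition3p6:
  fixes x0 x y :: "'a::vector_lattice"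
  shows "(strongly_related x0 x y \<longleftrightarrow>
            strongly_related x0 (pos_part x) (pos_part y) \<and>
            strongly_related x0 (neg_part x) (neg_part y)) \<and>
         (strongly_related x0 x y \<longleftrightarrow>
            strongly_related x0 (sup x y) (inf x y)) \<and>
         (strongly_related x0 x y \<longleftrightarrow>
            (\<forall>z. strongly_related x0 (sup x z) (sup y z) \<and>
                 strongly_related x0 (inf x z) (inf y z)))"
proof (intro conjI)
  show "strongly_related x0 x y \<longleftrightarrow>
      strongly_related x0 (pos_part x) (pos_part y) \<and>
      strongly_related x0 (neg_part x) (neg_part y)"
    using strongly_related_iff_sup_inf[of x0 x y 0]
    by (simp only: pos_part_eq_sup neg_part_eq_inf strongly_related_uminus)
  show "strongly_related x0 x y \<longleftrightarrow> strongly_related x0 (sup x y) (inf x y)"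
    by (simp only: strongly_related_def sup_diff_inf_eq_abs_diff orthogonal_def abs_idempotent)
  show "strongly_related x0 x y \<longleftrightarrow>
      (\<forall>z. strongly_related x0 (sup x z) (sup y z) \<and>
           strongly_related x0 (inf x z) (inf y z))"
    using strongly_related_iff_sup_inf[of x0 x y] by blast
qed

end
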